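(* Any bounded $L$-harmonic function on $\mathbb{S}\times\mathbb{R}^2$ or on $\mathbb{R}\times\mathbb{R}^2$ is constant.
   Context: $L$ is the generator of the kinetic Brownian motion, acting on functions of $(u,z_1,z_2)\in\mathbb{R}\times\mathbb{R}^2$ by $L=\frac12\partial_u^2+\cos(u)\,\partial_{z_1}+\sin(u)\,\partial_{z_2}$; the same formula defines $L$ on $\mathbb{S}\times\mathbb{R}^2$ with $\mathbb{S}=\mathbb{R}/2\pi\mathbb{Z}$. A function $f$ is $L$-harmonic if $Lf=0$. *)

theory Defs
  imports "HOL-Analysis.Analysis"
begin

section \<open>The circle as the quotient of the reals by \<open>2\<pi>\<int>\<close>\<close>

quotient_type circle = real / "\<lambda>x y. \<exists>k::int. y - x = 2 * pi * of_int k"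
  morphisms rep_circle to_circle
proof (rule equivpI)
  show "reflp (\<lambda>x y. \<exists>k::int. y - x = 2 * pi * of_int k)"
    by (auto intro!: reflpI exI[of _ 0])
  show "symp (\<lambda>x y. \<exists>k::int. y - x = 2 * pi * of_int k)"
  proof (rule sympI)
    fix x y :: real assume "\<exists>k::int. y - x = 2 * pi * of_int k"
    then obtain k :: int where "y - x = 2 * pi * of_int k" by blast
    then have "x - y = 2 * pi * of_int (- k)" by simp
    then show "\<exists>k::int. x - y = 2 * pi * of_int k" by blast
  qed
  show "transp (\<lambda>x y. \<exists>k::int. y - x = 2 * pi * of_int k)"
  proof (rule transpI)
    fix x y z :: real
    assume "\<exists>k::int. y - x = 2 * pi * of_int k" "\<exists>k::int. z - y = 2 * pi * of_int k"
    then obtain k l :: int where "y - x = 2 * pi * of_int k" "z - y = 2 * pi * of_int l" by blast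
    then have "z - x = 2 * pi * of_int (k + l)" by (simp add: algebra_simps)
    then show "\<exists>k::int. z - x = 2 * pi * of_int k" by blast
  qed
qed

instantiation circle :: ab_group_add
begin

lift_definition zero_circle :: circle is 0 .

lift_definition plus_circle :: "circle \<Rightarrow> circle \<Rightarrow> circle" is "(+)"
proof -
  fix x y x' y' :: real
  assume "\<exists>k::int. y - x = 2 * pi * of_int k" "\<exists>k::int. y' - x' = 2 * pi * of_int k"
  then obtain k l :: int where "y - x = 2 * pi * of_int k" "y' - x' = 2 * pi * of_int l" by blast
  then have "y + y' - (x + x') = 2 * pi * of_int (k + l)" by (simp add: algebra_simps)
  then show "\<exists>k::int. y + y' - (x + x') = 2 * pi * of_int k" by blast
qed

lift_definition uminus_circle :: "circle \<Rightarrow> circle" is uminus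
proof -
  fix x y :: real assume "\<exists>k::int. y - x = 2 * pi * of_int k"
  then obtain k :: int where "y - x = 2 * pi * of_int k" by blast
  then have "- y - - x = 2 * pi * of_int (- k)" by simp
  then show "\<exists>k::int. - y - - x = 2 * pi * of_int k" by blast
qed

definition minus_circle :: "circle \<Rightarrow> circle \<Rightarrow> circle" where
  "minus_circle a b = a + - b"

instance
proof
  fix a b c :: circle
  show "a + b + c = a + (b + c)" by transfer (auto intro!: exI[of _ 0])
  show "a + b = b + a" by transfer (auto intro!: exI[of _ 0])
  show "0 + a = a" by transfer (auto intro!: exI[of _ 0])
  show "- a + a = 0" by transfer (auto intro!: exI[of _ 0])
  show "a - b = a + - b" by (rule minus_circle_def)
qed

end

text \<open>The quotient topology.\<close>

instantiation circle :: topological_space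
begin

definition open_circle :: "circle set \<Rightarrow> bool" where
  "open_circle U \<longleftrightarrow> open (to_circle -` U)"

instance
proof
  show "open (UNIV :: circle set)" by (simp add: open_circle_def)
  show "open (S \<inter> T)" if "open S" "open T" for S T :: "circle set"
    using that by (auto simp: open_circle_def vimage_Int)
  show "open (\<Union> K)" if "\<forall>S\<in>K. open S" for K :: "circle set set"
    using that by (auto simp: open_circle_def vimage_Union)
qed

end

lift_definition cos_circle :: "circle \<Rightarrow> real" is cos
proof -
  fix x y :: real assume "\<exists>k::int. y - x = 2 * pi * of_int k"
  then obtain k :: int where "y = x + 2 * pi * of_int k" by (metis add.commute diff_add_cancel)
  then show "cos x = cos y" by (simp add: cos_add del: distrib_left_numeral)
qed

lift_definition sin_circle :: "circle \<Rightarrow> real" is sin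
proof -
  fix x y :: real assume "\<exists>k::int. y - x = 2 * pi * of_int k"
  then obtain k :: int where "y = x + 2 * pi * of_int k" by (metis add.commute diff_add_cancel)
  then show "sin x = sin y" by (simp add: sin_add del: distrib_left_numeral)
qed


section \<open>Partial derivatives\<close>

text \<open>Points are triples \<open>(u, z1, z2)\<close>, with \<open>u\<close> in the line or in the circle. The library's
  \<^const>\<open>deriv\<close> is unspecified where no derivative exists; existence is part of the regularity
  predicates below.\<close>

definition partial_z1 :: "('a \<times> real \<times> real \<Rightarrow> real) \<Rightarrow> 'a \<times> real \<times> real \<Rightarrow> real" where
  "partial_z1 f = (\<lambda>(u, z1, z2). deriv (\<lambda>t. f (u, t, z2)) z1)"

definition partial_z2 :: "('a \<times> real \<times> real \<Rightarrow> real) \<Rightarrow> 'a \<times> real \<times> real \<Rightarrow> real" where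
  "partial_z2 f = (\<lambda>(u, z1, z2). deriv (\<lambda>t. f (u, z1, t)) z2)"

definition partial_u :: "(real \<times> real \<times> real \<Rightarrow> real) \<Rightarrow> real \<times> real \<times> real \<Rightarrow> real" where
  "partial_u f = (\<lambda>(u, z1, z2). deriv (\<lambda>t. f (t, z1, z2)) u)"

text \<open>On the circle the derivative at \<open>u\<close> is taken along \<open>t \<mapsto> u + [t]\<close> at \<open>t = 0\<close>.\<close>

definition partial_u_circle ::
  "(circle \<times> real \<times> real \<Rightarrow> real) \<Rightarrow> circle \<times> real \<times> real \<Rightarrow> real" where
  "partial_u_circle f = (\<lambda>(u, z1, z2). deriv (\<lambda>t. f (u + to_circle t, z1, z2)) 0)"


section \<open>The generator of kinetic Brownian motion and its harmonic functions\<close>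

definition kinetic_gen :: "(real \<times> real \<times> real \<Rightarrow> real) \<Rightarrow> real \<times> real \<times> real \<Rightarrow> real" where
  "kinetic_gen f = (\<lambda>(u, z1, z2).
     1 / 2 * partial_u (partial_u f) (u, z1, z2)
     + cos u * partial_z1 f (u, z1, z2)
     + sin u * partial_z2 f (u, z1, z2))"

definition kinetic_gen_circle ::
  "(circle \<times> real \<times> real \<Rightarrow> real) \<Rightarrow> circle \<times> real \<times> real \<Rightarrow> real" where
  "kinetic_gen_circle f = (\<lambda>(u, z1, z2).
     1 / 2 * partial_u_circle (partial_u_circle f) (u, z1, z2)
     + cos_circle u * partial_z1 f (u, z1, z2)
     + sin_circle u * partial_z2 f (u, z1, z2))"

text \<open>Functions to which the second-order operator applies classically: the derivatives occurring
  in it exist everywhere and, like the function itself, are continuous. This class contains all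
  \<open>C\<^sup>2\<close> functions, and only one continuous derivative is asked for in \<open>z1\<close> and \<open>z2\<close>.\<close>

definition kinetic_regular :: "(real \<times> real \<times> real \<Rightarrow> real) \<Rightarrow> bool" where
  "kinetic_regular f \<longleftrightarrow>
     (\<forall>u z1 z2.
        (\<lambda>t. f (t, z1, z2)) differentiable (at u) \<and>
        (\<lambda>t. partial_u f (t, z1, z2)) differentiable (at u) \<and>
        (\<lambda>t. f (u, t, z2)) differentiable (at z1) \<and>
        (\<lambda>t. f (u, z1, t)) differentiable (at z2)) \<and>
     continuous_on UNIV f \<and>
     continuous_on UNIV (partial_u f) \<and>
     continuous_on UNIV (partial_u (partial_u f)) \<and>
     continuous_on UNIV (partial_z1 f) \<and>
     continuous_on UNIV (partial_z2 f)"

definition kinetic_regular_circle :: "(circle \<times> real \<times> real \<Rightarrow> real) \<Rightarrow> bool" where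
  "kinetic_regular_circle f \<longleftrightarrow>
     (\<forall>u z1 z2.
        (\<lambda>t. f (u + to_circle t, z1, z2)) differentiable (at 0) \<and>
        (\<lambda>t. partial_u_circle f (u + to_circle t, z1, z2)) differentiable (at 0) \<and>
        (\<lambda>t. f (u, t, z2)) differentiable (at z1) \<and>
        (\<lambda>t. f (u, z1, t)) differentiable (at z2)) \<and>
     continuous_on UNIV f \<and>
     continuous_on UNIV (partial_u_circle f) \<and>
     continuous_on UNIV (partial_u_circle (partial_u_circle f)) \<and>
     continuous_on UNIV (partial_z1 f) \<and>
     continuous_on UNIV (partial_z2 f)"

definition L_harmonic :: "(real \<times> real \<times> real \<Rightarrow> real) \<Rightarrow> bool" where
  "L_harmonic f \<longleftrightarrow> kinetic_regular f \<and> (\<forall>p. kinetic_gen f p = 0)"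

definition L_harmonic_circle :: "(circle \<times> real \<times> real \<Rightarrow> real) \<Rightarrow> bool" where
  "L_harmonic_circle f \<longleftrightarrow> kinetic_regular_circle f \<and> (\<forall>p. kinetic_gen_circle f p = 0)"

end

theory Submission
  imports Defs
begin

text \<open>A circle-harmonic function lifts to one on the line, so let \<open>f\<close> be bounded and harmonic on
  \<open>\<real> \<times> \<real>\<^sup>2\<close>. Since \<open>L\<close> commutes with translations in the plane, averaging \<open>f\<close> over small boxes in
  \<open>z\<close> gives a harmonic function with bounded harmonic \<open>z\<close>-gradient, and the equation then bounds
  \<open>f\<^sub>u\<^sub>u\<close> and hence \<open>f\<^sub>u\<close>. A Bernstein argument with mixed (hypoelliptic) terms produces a bounded
  quadratic form \<open>Q\<close> in \<open>f, f\<^sub>u, \<nabla>\<^sub>zf\<close> with \<open>L Q \<ge> \<bar>\<nabla>\<^sub>zf\<bar>\<^sup>2 / 2\<close>, while \<open>L \<bar>\<nabla>\<^sub>zf\<bar>\<^sup>2 \<ge> 0\<close>. The maximum principle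
  at infinity for \<open>\<bar>\<nabla>\<^sub>zf\<bar>\<^sup>2 + \<epsilon> Q\<close> with \<open>\<epsilon> \<rightarrow> 0\<close> forces \<open>\<nabla>\<^sub>zf = 0\<close>. Shrinking the boxes, the original \<open>f\<close>
  depends on \<open>u\<close> only, and \<open>f\<^sub>u\<^sub>u = 0\<close> with \<open>f\<close> bounded makes it constant.\<close>

section \<open>Calculus on the line\<close>

text \<open>With an antiderivative \<open>F\<close> of \<open>h\<close> on the whole line, the
  window integral is \<open>F (x + a) - F x\<close>. A merely continuous \<open>h\<close> thus gains
  a derivative, which is how averaging over boxes smooths in the plane.\<close>

lemma has_real_derivative_integral_window:
  fixes h :: "real \<Rightarrow> real"
  assumes h: "continuous_on UNIV h" and a: "0 \<le> a"
  shows "((\<lambda>x. integral {0..a} (\<lambda>s. h (x + s))) has_real_derivative h (x + a) - h x) (at x)"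
proof -
  have "\<exists>F. \<forall>x::real. -\<infinity> < ereal x \<longrightarrow> ereal x < \<infinity> \<longrightarrow> (F has_vector_derivative h x) (at x)"
    using h by (intro einterval_antiderivative) (auto simp: continuous_on_eq_continuous_at)
  then obtain F where F: "(F has_real_derivative h x) (at x)" for x
    by (auto simp: has_real_derivative_iff_has_vector_derivative)
  have "integral {0..a} (\<lambda>s. h (x + s)) = F (x + a) - F x" for x
  proof (rule integral_unique)
    have "((\<lambda>s. F (x + s)) has_real_derivative h (x + s)) (at s)" for s
      using F[of "s + x", unfolded DERIV_shift] by (simp add: add.commute)
    then have "((\<lambda>s. h (x + s)) has_integral F (x + a) - F (x + 0)) {0..a}"
      using a by (intro fundamental_theorem_of_calculus)
        (auto simp: has_real_derivative_iff_has_vector_derivative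
              intro: has_vector_derivative_at_within)
    then show "((\<lambda>s. h (x + s)) has_integral F (x + a) - F x) {0..a}" by simp
  qed
  moreover have "((\<lambda>x. F (x + a) - F x) has_real_derivative h (x + a) - h x) (at x)"
    using F[of "x + a", unfolded DERIV_shift] F[of x] by (rule DERIV_diff)
  ultimately show ?thesis by simp
qed

lemma has_real_derivative_integral_param:
  fixes h h' :: "real \<Rightarrow> real \<Rightarrow> real"
  assumes "\<And>x s. ((\<lambda>x. h x s) has_real_derivative h' x s) (at x)"
    and "continuous_on UNIV (\<lambda>p. h' (fst p) (snd p))" and "\<And>x. continuous_on UNIV (h x)"
  shows "((\<lambda>x. integral {0..a} (h x)) has_real_derivative integral {0..a} (h' x)) (at x)"
proof -
  have "((\<lambda>x. integral (cbox 0 a) (h x)) has_real_derivative integral (cbox 0 a) (h' x))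
      (at x within UNIV)"
    using assms(1)
    by (intro leibniz_rule_field_derivative)
      (auto simp: split_beta intro: continuous_on_subset[OF assms(2)]
         continuous_on_subset[OF assms(3)] intro!: integrable_continuous_interval)
  then show ?thesis by simp
qed

lemma continuous_on_integral_param:
  fixes h :: "'a::topological_space \<Rightarrow> real \<Rightarrow> real"
  assumes "continuous_on UNIV (\<lambda>p. h (fst p) (snd p))"
  shows "continuous_on UNIV (\<lambda>x. integral {0..a} (h x))"
  using integral_continuous_on_param[of UNIV 0 a h] continuous_on_subset[OF assms]
  by (simp add: split_beta)

text \<open>If \<open>c\<close> were positive, \<open>\<phi>'\<close> would be positive just to the
  right of its zero \<open>x\<close>, and the mean value theorem would give a value of
  \<open>\<phi>\<close> above the maximum.\<close>

lemma second_derivative_at_maximum: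
  fixes \<phi> \<phi>' :: "real \<Rightarrow> real"
  assumes d: "\<And>t. (\<phi> has_real_derivative \<phi>' t) (at t)"
    and d2: "(\<phi>' has_real_derivative c) (at x)" and m: "\<And>t. \<phi> t \<le> \<phi> x"
  shows "\<phi>' x = 0" "c \<le> 0"
proof -
  show 0: "\<phi>' x = 0"
    using DERIV_local_max[OF d, of 1] m by simp
  show "c \<le> 0"
  proof (rule ccontr)
    assume "\<not> c \<le> 0"
    then obtain e where e: "e > 0" "\<And>h. h > 0 \<Longrightarrow> h < e \<Longrightarrow> \<phi>' x < \<phi>' (x + h)"
      using DERIV_pos_inc_right[OF d2] by auto
    obtain z where z: "x < z" "z < x + e/2" "\<phi> (x + e/2) - \<phi> x = (x + e/2 - x) * \<phi>' z"
      using MVT2[of x "x + e/2" \<phi> \<phi>'] d e by auto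
    have "\<phi>' z > 0" using e(2)[of "z - x"] z e(1) 0 by simp
    then have "\<phi> (x + e/2) > \<phi> x" using z(3) e(1)
      by (metis add_diff_cancel_left' diff_gt_0_iff_gt half_gt_zero mult_pos_pos)
    then show False using m[of "x + e/2"] by simp
  qed
qed

text \<open>Landau's inequality, in a form that yields the boundedness of \<open>\<phi>'\<close> as well as (with
  \<open>K = 0\<close>, \<open>h \<rightarrow> \<infinity>\<close>) its vanishing.\<close>

lemma landau_derivative_bound:
  fixes \<phi> \<phi>' \<phi>'' :: "real \<Rightarrow> real"
  assumes d: "\<And>t. (\<phi> has_real_derivative \<phi>' t) (at t)"
    and d2: "\<And>t. (\<phi>' has_real_derivative \<phi>'' t) (at t)"
    and C: "\<And>t. \<bar>\<phi> t\<bar> \<le> C" and K: "\<And>t. \<bar>\<phi>'' t\<bar> \<le> K" and h: "h > 0"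
  shows "\<bar>\<phi>' x\<bar> \<le> 2 * C / h + K * h"
proof -
  \<comment> \<open>The slope at some \<open>z\<close> within distance \<open>h\<close> is a
    difference quotient, at most \<open>2 * C / h\<close>; a second mean value point bounds the
    change of \<open>\<phi>'\<close> from \<open>x\<close> to \<open>z\<close> by
    \<open>K * h\<close>.\<close>
  obtain z where z: "x < z" "z < x + h" "\<phi> (x + h) - \<phi> x = (x + h - x) * \<phi>' z"
    using MVT2[of x "x + h" \<phi> \<phi>'] d h by auto
  obtain w where w: "\<phi>' z - \<phi>' x = (z - x) * \<phi>'' w"
    using MVT2[of x z \<phi>' \<phi>''] d2 z by auto
  have K0: "0 \<le> K" using K[of 0] by linarith
  have "\<phi>' z = (\<phi> (x + h) - \<phi> x) / h" using z(3) h by simp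
  moreover have "\<bar>\<phi> (x + h) - \<phi> x\<bar> \<le> 2 * C" using C[of "x + h"] C[of x] by linarith
  ultimately have "\<bar>\<phi>' z\<bar> \<le> 2 * C / h" using h by (simp add: abs_divide divide_right_mono)
  moreover have "\<bar>\<phi>' z - \<phi>' x\<bar> \<le> K * h"
    unfolding w abs_mult using z(1,2) K[of w] K0 h
    by (subst mult.commute) (intro mult_mono, auto)
  ultimately show ?thesis by linarith
qed

section \<open>Functions with a classical value of the generator\<close>

text \<open>\<open>has_gen p pu l\<close>: \<open>pu\<close> is the \<open>u\<close>-derivative of \<open>p\<close> and \<open>L p = l\<close>.\<close>

definition has_gen ::
  "(real \<times> real \<times> real \<Rightarrow> real) \<Rightarrow> (real \<times> real \<times> real \<Rightarrow> real) \<Rightarrow> (real \<times> real \<times> real \<Rightarrow> real) \<Rightarrow> bool"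
where
  "has_gen p pu l \<longleftrightarrow> (\<exists>puu px py. \<forall>u x y.
     ((\<lambda>t. p (t, x, y)) has_real_derivative pu (u, x, y)) (at u) \<and>
     ((\<lambda>t. pu (t, x, y)) has_real_derivative puu (u, x, y)) (at u) \<and>
     ((\<lambda>t. p (u, t, y)) has_real_derivative px (u, x, y)) (at x) \<and>
     ((\<lambda>t. p (u, x, t)) has_real_derivative py (u, x, y)) (at y) \<and>
     l (u, x, y) = puu (u, x, y) / 2 + cos u * px (u, x, y) + sin u * py (u, x, y))"

lemma has_gen_add:
  assumes "has_gen p pu lp" "has_gen q qu lq"
  shows "has_gen (\<lambda>z. p z + q z) (\<lambda>z. pu z + qu z) (\<lambda>z. lp z + lq z)"
proof -
  obtain puu px py where p: "\<And>u x y.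
     ((\<lambda>t. p (t, x, y)) has_real_derivative pu (u, x, y)) (at u)"
     "\<And>u x y. ((\<lambda>t. pu (t, x, y)) has_real_derivative puu (u, x, y)) (at u)"
     "\<And>u x y. ((\<lambda>t. p (u, t, y)) has_real_derivative px (u, x, y)) (at x)"
     "\<And>u x y. ((\<lambda>t. p (u, x, t)) has_real_derivative py (u, x, y)) (at y)"
     "\<And>u x y. lp (u, x, y) = puu (u, x, y) / 2 + cos u * px (u, x, y) + sin u * py (u, x, y)"
    using assms(1) unfolding has_gen_def by blast
  obtain quu qx qy where q: "\<And>u x y.
     ((\<lambda>t. q (t, x, y)) has_real_derivative qu (u, x, y)) (at u)"
     "\<And>u x y. ((\<lambda>t. qu (t, x, y)) has_real_derivative quu (u, x, y)) (at u)"
     "\<And>u x y. ((\<lambda>t. q (u, t, y)) has_real_derivative qx (u, x, y)) (at x)"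
     "\<And>u x y. ((\<lambda>t. q (u, x, t)) has_real_derivative qy (u, x, y)) (at y)"
     "\<And>u x y. lq (u, x, y) = quu (u, x, y) / 2 + cos u * qx (u, x, y) + sin u * qy (u, x, y)"
    using assms(2) unfolding has_gen_def by blast
  show ?thesis
    unfolding has_gen_def
    by (rule exI[of _ "\<lambda>z. puu z + quu z"], rule exI[of _ "\<lambda>z. px z + qx z"],
        rule exI[of _ "\<lambda>z. py z + qy z"])
      (auto intro!: DERIV_add p(1-4) q(1-4) simp: p(5) q(5) algebra_simps add_divide_distrib)
qed

text \<open>The half in front of the second derivative cancels the 2 of the Leibniz rule, leaving
  the cross term \<open>pu * qu\<close>. With \<open>p = q\<close> it is a square, the source of all
  positivity used later.\<close>

lemma has_gen_mult:
  assumes "has_gen p pu lp" "has_gen q qu lq"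
  shows "has_gen (\<lambda>z. p z * q z) (\<lambda>z. pu z * q z + p z * qu z)
    (\<lambda>z. lp z * q z + p z * lq z + pu z * qu z)"
proof -
  obtain puu px py where p: "\<And>u x y.
     ((\<lambda>t. p (t, x, y)) has_real_derivative pu (u, x, y)) (at u)"
     "\<And>u x y. ((\<lambda>t. pu (t, x, y)) has_real_derivative puu (u, x, y)) (at u)"
     "\<And>u x y. ((\<lambda>t. p (u, t, y)) has_real_derivative px (u, x, y)) (at x)"
     "\<And>u x y. ((\<lambda>t. p (u, x, t)) has_real_derivative py (u, x, y)) (at y)"
     "\<And>u x y. lp (u, x, y) = puu (u, x, y) / 2 + cos u * px (u, x, y) + sin u * py (u, x, y)"
    using assms(1) unfolding has_gen_def by blast
  obtain quu qx qy where q: "\<And>u x y.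
     ((\<lambda>t. q (t, x, y)) has_real_derivative qu (u, x, y)) (at u)"
     "\<And>u x y. ((\<lambda>t. qu (t, x, y)) has_real_derivative quu (u, x, y)) (at u)"
     "\<And>u x y. ((\<lambda>t. q (u, t, y)) has_real_derivative qx (u, x, y)) (at x)"
     "\<And>u x y. ((\<lambda>t. q (u, x, t)) has_real_derivative qy (u, x, y)) (at y)"
     "\<And>u x y. lq (u, x, y) = quu (u, x, y) / 2 + cos u * qx (u, x, y) + sin u * qy (u, x, y)"
    using assms(2) unfolding has_gen_def by blast
  show ?thesis
    unfolding has_gen_def
    by (rule exI[of _ "\<lambda>z. puu z * q z + 2 * (pu z * qu z) + p z * quu z"],
        rule exI[of _ "\<lambda>z. px z * q z + p z * qx z"],
        rule exI[of _ "\<lambda>z. py z * q z + p z * qy z"], intro allI conjI)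
      (rule derivative_eq_intros p(1-4) q(1-4) refl | simp add: p(5) q(5) field_simps)+
qed

lemma has_gen_const: "has_gen (\<lambda>z. c) (\<lambda>z. 0) (\<lambda>z. 0)"
  unfolding has_gen_def by (rule exI[of _ "\<lambda>z. 0"])+ auto

lemma has_gen_cmult: "has_gen p pu l \<Longrightarrow> has_gen (\<lambda>z. c * p z) (\<lambda>z. c * pu z) (\<lambda>z. c * l z)"
  using has_gen_mult[OF has_gen_const[of c], of p pu l] by simp

lemma has_gen_cos: "has_gen (\<lambda>z. cos (fst z)) (\<lambda>z. - sin (fst z)) (\<lambda>z. - cos (fst z) / 2)"
  unfolding has_gen_def
  by (rule exI[of _ "\<lambda>z. - cos (fst z)"], rule exI[of _ "\<lambda>z. 0"], rule exI[of _ "\<lambda>z. 0"])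
    (auto intro!: derivative_eq_intros)

lemma has_gen_sin: "has_gen (\<lambda>z. sin (fst z)) (\<lambda>z. cos (fst z)) (\<lambda>z. - sin (fst z) / 2)"
  unfolding has_gen_def
  by (rule exI[of _ "\<lambda>z. - sin (fst z)"], rule exI[of _ "\<lambda>z. 0"], rule exI[of _ "\<lambda>z. 0"])
    (auto intro!: derivative_eq_intros)

section \<open>A coercive barrier and the maximum principle at infinity\<close>

definition log_barrier :: "real \<times> real \<times> real \<Rightarrow> real" where
  "log_barrier = (\<lambda>(u, x, y). ln (1 + u\<^sup>2) + ln (1 + x\<^sup>2) + ln (1 + y\<^sup>2))"

lemma log_barrier_nonneg: "0 \<le> log_barrier p"
  by (auto simp: log_barrier_def split_beta intro!: add_nonneg_nonneg ln_ge_zero)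

lemma continuous_on_log_barrier: "continuous_on UNIV log_barrier"
  unfolding log_barrier_def split_beta
  by (intro continuous_intros) (auto simp: add_nonneg_eq_0_iff)

text \<open>These bounds make the generator of \<open>log_barrier\<close> at most 3: half of the
  second derivative contributes at most 1, and so does each of the two drift terms.\<close>

lemma ln_one_plus_square_derivatives:
  fixes t :: real
  shows "((\<lambda>t. ln (1 + t\<^sup>2)) has_real_derivative 2 * t / (1 + t\<^sup>2)) (at t)"
    and "((\<lambda>t. 2 * t / (1 + t\<^sup>2)) has_real_derivative (2 - 2 * t\<^sup>2) / (1 + t\<^sup>2)\<^sup>2) (at t)"
    and "\<bar>2 * t / (1 + t\<^sup>2)\<bar> \<le> 1" and "(2 - 2 * t\<^sup>2) / (1 + t\<^sup>2)\<^sup>2 \<le> 2"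
proof -
  have pos: "1 + t\<^sup>2 > 0" by (simp add: add_pos_nonneg)
  show "((\<lambda>t. ln (1 + t\<^sup>2)) has_real_derivative 2 * t / (1 + t\<^sup>2)) (at t)"
    using pos by (auto intro!: derivative_eq_intros)
  show "((\<lambda>t. 2 * t / (1 + t\<^sup>2)) has_real_derivative (2 - 2 * t\<^sup>2) / (1 + t\<^sup>2)\<^sup>2) (at t)"
    using pos by (auto intro!: derivative_eq_intros simp: power2_eq_square algebra_simps)
  have "0 \<le> (1 - t)\<^sup>2" "0 \<le> (1 + t)\<^sup>2" by auto
  then have "\<bar>2 * t\<bar> \<le> 1 + t\<^sup>2" by (simp add: power2_eq_square algebra_simps abs_le_iff)
  then show "\<bar>2 * t / (1 + t\<^sup>2)\<bar> \<le> 1" using pos by (simp add: abs_divide divide_le_eq)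
  have "1 \<le> (1 + t\<^sup>2)\<^sup>2" by (simp add: one_le_power)
  then have "2 - 2 * t\<^sup>2 \<le> 2 * (1 + t\<^sup>2)\<^sup>2"
    by (smt (verit) zero_le_power2)
  then show "(2 - 2 * t\<^sup>2) / (1 + t\<^sup>2)\<^sup>2 \<le> 2" using pos by (simp add: divide_le_eq)
qed

text \<open>The three logarithms are nonnegative, so each is at most \<open>K\<close>, which
  confines each coordinate to the interval from \<open>- exp K\<close> to
  \<open>exp K\<close>.\<close>

lemma bounded_log_barrier_sublevel: "bounded {p. log_barrier p \<le> K}"
proof -
  have key: "\<bar>t\<bar> \<le> exp K" if "ln (1 + t\<^sup>2) \<le> K" for t :: real
  proof -
    have "1 + t\<^sup>2 \<le> exp K"
      using that by (metis add_pos_nonneg exp_le_cancel_iff exp_ln zero_le_power2 zero_less_one)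
    moreover have "\<bar>t\<bar> \<le> 1 + t\<^sup>2"
    proof -
      have "0 \<le> (1 - \<bar>t\<bar>)\<^sup>2" by simp
      then have "2 * \<bar>t\<bar> \<le> 1 + t\<^sup>2" by (simp add: power2_eq_square algebra_simps)
      then show ?thesis by linarith
    qed
    ultimately show ?thesis by linarith
  qed
  have nn: "0 \<le> ln (1 + t\<^sup>2)" for t :: real by simp
  have "{p. log_barrier p \<le> K} \<subseteq> {-exp K..exp K} \<times> {-exp K..exp K} \<times> {-exp K..exp K}"
  proof (clarsimp simp: log_barrier_def)
    fix u x y :: real assume "ln (1 + u\<^sup>2) + ln (1 + x\<^sup>2) + ln (1 + y\<^sup>2) \<le> K"
    then have "ln (1 + u\<^sup>2) \<le> K" "ln (1 + x\<^sup>2) \<le> K" "ln (1 + y\<^sup>2) \<le> K"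
      using nn[of u] nn[of x] nn[of y] by linarith+
    then have "\<bar>u\<bar> \<le> exp K" "\<bar>x\<bar> \<le> exp K" "\<bar>y\<bar> \<le> exp K"
      by (auto intro: key)
    then show "- exp K \<le> u \<and> u \<le> exp K \<and> - exp K \<le> x \<and> x \<le> exp K \<and> - exp K \<le> y \<and> y \<le> exp K"
      by auto
  qed
  then show ?thesis
    by (rule bounded_subset[rotated]) (intro bounded_Times bounded_closed_interval)
qed

text \<open>The Omori-Yau maximum principle: subtracting a small multiple of the coercive
  \<open>log_barrier\<close>, whose image under \<open>L\<close> is bounded, makes the supremum attained.\<close>

lemma has_gen_almost_maximum:
  assumes g: "has_gen W Wu l" and cont: "continuous_on UNIV W" and bd: "\<And>p. W p \<le> B"
    and \<eta>: "\<eta> > 0"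
  obtains p where "W q - \<eta> \<le> W p" "l p \<le> \<eta>"
proof -
  obtain Wuu Wx Wy where W: "\<And>u x y.
     ((\<lambda>t. W (t, x, y)) has_real_derivative Wu (u, x, y)) (at u)"
     "\<And>u x y. ((\<lambda>t. Wu (t, x, y)) has_real_derivative Wuu (u, x, y)) (at u)"
     "\<And>u x y. ((\<lambda>t. W (u, t, y)) has_real_derivative Wx (u, x, y)) (at x)"
     "\<And>u x y. ((\<lambda>t. W (u, x, t)) has_real_derivative Wy (u, x, y)) (at y)"
     "\<And>u x y. l (u, x, y) = Wuu (u, x, y) / 2 + cos u * Wx (u, x, y) + sin u * Wy (u, x, y)"
    using g unfolding has_gen_def by blast
  \<comment> \<open>This size makes both the generator of the penalty, at most
    \<open>3 * \<delta>\<close>, and the penalty at \<open>q\<close> at most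
    \<open>\<eta>\<close>.\<close>
  define \<delta> where "\<delta> = \<eta> / (3 + log_barrier q)"
  have \<delta>: "\<delta> > 0" "3 * \<delta> \<le> \<eta>" "\<delta> * log_barrier q \<le> \<eta>"
    using \<eta> log_barrier_nonneg[of q] by (auto simp: \<delta>_def field_simps)
  define V where "V p = W p - \<delta> * log_barrier p" for p
  have cV: "continuous_on UNIV V"
    unfolding V_def by (intro continuous_intros cont continuous_on_log_barrier)
  let ?S = "{p. V q \<le> V p}"
  \<comment> \<open>As \<open>W \<le> B\<close>, the superlevel set of \<open>V\<close> through
    \<open>q\<close> lies in a sublevel set of the barrier and is compact; a maximum of
    \<open>V\<close> on it is a global one.\<close>
  have "?S \<subseteq> {p. log_barrier p \<le> (B - V q) / \<delta>}"
    using \<delta>(1) bd by (auto simp: V_def field_simps) (smt (verit, best) bd)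
  then have "bounded ?S" using bounded_log_barrier_sublevel bounded_subset by blast
  moreover have "closed ?S" by (intro closed_Collect_le continuous_intros cV)
  ultimately have "compact ?S" by (simp add: compact_eq_bounded_closed)
  moreover have "q \<in> ?S" by simp
  then have "?S \<noteq> {}" by blast
  ultimately obtain p where p: "V q \<le> V p" "\<And>p'. p' \<in> ?S \<Longrightarrow> V p' \<le> V p"
    using continuous_attains_sup[of ?S V] continuous_on_subset[OF cV] by auto
  have max: "V p' \<le> V p" for p' using p(1) p(2)[of p'] by (cases "V q \<le> V p'") auto
  obtain u x y where pe: "p = (u, x, y)" by (cases p)
  note lnd = ln_one_plus_square_derivatives
  \<comment> \<open>At the maximum of \<open>V\<close> the derivatives of \<open>W\<close> are
    controlled by those of the penalty: half of \<open>Wuu\<close> is at most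
    \<open>\<delta>\<close>, and \<open>Wx\<close>, \<open>Wy\<close> are at most
    \<open>\<delta>\<close> in absolute value.\<close>
  have "((\<lambda>t. V (t, x, y)) has_real_derivative Wu (t, x, y) - \<delta> * (2 * t / (1 + t\<^sup>2))) (at t)" for t
    unfolding V_def log_barrier_def split by (rule derivative_eq_intros W lnd refl | simp)+
  moreover have "((\<lambda>t. Wu (t, x, y) - \<delta> * (2 * t / (1 + t\<^sup>2))) has_real_derivative
      Wuu (u, x, y) - \<delta> * ((2 - 2 * u\<^sup>2) / (1 + u\<^sup>2)\<^sup>2)) (at u)"
    by (intro DERIV_diff W DERIV_cmult lnd)
  ultimately have "Wuu (u, x, y) - \<delta> * ((2 - 2 * u\<^sup>2) / (1 + u\<^sup>2)\<^sup>2) \<le> 0"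
    using max unfolding pe by (rule second_derivative_at_maximum(2))
  moreover have "\<delta> * ((2 - 2 * u\<^sup>2) / (1 + u\<^sup>2)\<^sup>2) \<le> \<delta> * 2"
    using lnd(4)[of u] \<delta>(1) by (intro mult_left_mono) auto
  ultimately have uu: "Wuu (u, x, y) \<le> 2 * \<delta>" by linarith
  have "((\<lambda>t. V (u, t, y)) has_real_derivative Wx (u, x, y) - \<delta> * (2 * x / (1 + x\<^sup>2))) (at x)"
    unfolding V_def log_barrier_def split by (rule derivative_eq_intros W lnd refl | simp)+
  then have "Wx (u, x, y) - \<delta> * (2 * x / (1 + x\<^sup>2)) = 0"
    by (rule DERIV_local_max[of _ _ _ 1]) (use max pe in auto)
  moreover have "\<bar>\<delta> * (2 * x / (1 + x\<^sup>2))\<bar> \<le> \<delta> * 1"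
    unfolding abs_mult using lnd(3)[of x] \<delta>(1) by (intro mult_mono) auto
  ultimately have "\<bar>Wx (u, x, y)\<bar> \<le> \<delta>" by linarith
  then have "\<bar>cos u * Wx (u, x, y)\<bar> \<le> 1 * \<delta>"
    unfolding abs_mult by (intro mult_mono) auto
  moreover have "((\<lambda>t. V (u, x, t)) has_real_derivative Wy (u, x, y) - \<delta> * (2 * y / (1 + y\<^sup>2))) (at y)"
    unfolding V_def log_barrier_def split by (rule derivative_eq_intros W lnd refl | simp)+
  then have "Wy (u, x, y) - \<delta> * (2 * y / (1 + y\<^sup>2)) = 0"
    by (rule DERIV_local_max[of _ _ _ 1]) (use max pe in auto)
  moreover have "\<bar>\<delta> * (2 * y / (1 + y\<^sup>2))\<bar> \<le> \<delta> * 1"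
    unfolding abs_mult using lnd(3)[of y] \<delta>(1) by (intro mult_mono) auto
  ultimately have "\<bar>cos u * Wx (u, x, y)\<bar> \<le> \<delta>" "\<bar>Wy (u, x, y)\<bar> \<le> \<delta>" by linarith+
  moreover from this(2) have "\<bar>sin u * Wy (u, x, y)\<bar> \<le> 1 * \<delta>"
    unfolding abs_mult by (intro mult_mono) auto
  ultimately have "l p \<le> \<eta>" unfolding pe W(5) using uu \<delta>(2) by linarith
  moreover have "0 \<le> \<delta> * log_barrier p" using \<delta>(1) log_barrier_nonneg[of p] by simp
  then have "W q - \<eta> \<le> W p" using p(1) \<delta>(3) unfolding V_def by linarith
  ultimately show thesis using that by blast
qed

section \<open>Harmonic functions together with their derivatives\<close>

text \<open>Derivatives are explicit functions instead of values of \<open>deriv\<close>, so that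
  translates, differences, box averages and lifts from the circle can each name their own.
  Continuity permits differentiation under the integral.\<close>

definition harmonic_jet where
  "harmonic_jet f fu fuu fx fy \<longleftrightarrow>
     (\<forall>u x y :: real.
        ((\<lambda>t. f (t, x, y)) has_real_derivative fu (u, x, y)) (at u) \<and>
        ((\<lambda>t. fu (t, x, y)) has_real_derivative fuu (u, x, y)) (at u) \<and>
        ((\<lambda>t. f (u, t, y)) has_real_derivative fx (u, x, y)) (at x) \<and>
        ((\<lambda>t. f (u, x, t)) has_real_derivative fy (u, x, y)) (at y) \<and>
        fuu (u, x, y) / 2 + cos u * fx (u, x, y) + sin u * fy (u, x, y) = 0) \<and>
     continuous_on UNIV f \<and> continuous_on UNIV fu \<and> continuous_on UNIV fuu \<and>
     continuous_on UNIV fx \<and> continuous_on UNIV fy"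

lemma harmonic_jet_has_gen:
  assumes "harmonic_jet f fu fuu fx fy"
  shows "has_gen f fu (\<lambda>z. 0)"
  unfolding has_gen_def
  by (rule exI[of _ fuu], rule exI[of _ fx], rule exI[of _ fy])
    (use assms in \<open>auto simp: harmonic_jet_def\<close>)

text \<open>With \<open>a = f\<^sub>u\<close>, \<open>X = e(u)\<cdot>\<nabla>f\<close>, \<open>Y = e'(u)\<cdot>\<nabla>f\<close>, \<open>\<alpha> = e(u)\<cdot>\<nabla>f\<^sub>u\<close>, \<open>\<beta> = e'(u)\<cdot>\<nabla>f\<^sub>u\<close> for
  \<open>e(u) = (cos u, sin u)\<close>, the function \<open>Q = 2 f\<^sup>2 + a\<^sup>2 - a Y + \<bar>\<nabla>f\<bar>\<^sup>2\<close> satisfies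
  \<open>L Q = 2 a\<^sup>2 + 2 X\<^sup>2 + Y\<^sup>2 - 3/2 a Y + a \<alpha> + 2 X \<beta> + \<alpha>\<^sup>2 + \<beta>\<^sup>2\<close>; its coefficients are chosen
  such that this dominates \<open>\<bar>\<nabla>f\<bar>\<^sup>2 / 2\<close>.\<close>

lemma lyapunov_inequality:
  fixes a c s p q pu qu :: real
  assumes cs: "c\<^sup>2 + s\<^sup>2 = 1"
  defines "X \<equiv> c * p + s * q" and "Y \<equiv> c * q - s * p"
    and "\<alpha> \<equiv> c * pu + s * qu" and "\<beta> \<equiv> c * qu - s * pu"
  shows "(p\<^sup>2 + q\<^sup>2) / 2 \<le>
    2 * a\<^sup>2 + 4 * X\<^sup>2 - 2 * a * Y - (- Y * Y + a * (- Y / 2 - \<alpha>) + (- 2 * X) * (\<beta> - X)) + (pu\<^sup>2 + qu\<^sup>2)"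
proof -
  \<comment> \<open>\<open>(X, Y)\<close> and \<open>(\<alpha>, \<beta>)\<close> are the coordinates
    of \<open>(p, q)\<close> and \<open>(pu, qu)\<close> in the orthonormal frame
    \<open>(c, s)\<close>, \<open>(- s, c)\<close>.\<close>
  have rot: "p\<^sup>2 + q\<^sup>2 = X\<^sup>2 + Y\<^sup>2" "pu\<^sup>2 + qu\<^sup>2 = \<alpha>\<^sup>2 + \<beta>\<^sup>2"
    using cs unfolding X_def Y_def \<alpha>_def \<beta>_def by algebra+
  \<comment> \<open>Completing squares: each square absorbs one of the mixed terms in
    \<open>a * Y\<close>, \<open>a * \<alpha>\<close> and \<open>X * \<beta>\<close>. The budget
    \<open>2 * a\<^sup>2\<close> is spent as 9/8 + 1/4 + 5/8.\<close>
  have "2 * a\<^sup>2 + 4 * X\<^sup>2 - 2 * a * Y - (- Y * Y + a * (- Y / 2 - \<alpha>) + (- 2 * X) * (\<beta> - X)) + (\<alpha>\<^sup>2 + \<beta>\<^sup>2)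
      - (X\<^sup>2 + Y\<^sup>2) / 2
    = (Y - 3/2 * a)\<^sup>2 / 2 + (a / 2 + \<alpha>)\<^sup>2 + (X + \<beta>)\<^sup>2 + 5/8 * a\<^sup>2 + X\<^sup>2 / 2"
    by (simp add: power2_eq_square field_simps)
  moreover have "0 \<le> (Y - 3/2 * a)\<^sup>2 / 2 + (a / 2 + \<alpha>)\<^sup>2 + (X + \<beta>)\<^sup>2 + 5/8 * a\<^sup>2 + X\<^sup>2 / 2" by simp
  ultimately show ?thesis unfolding rot by linarith
qed


lemma has_gen_cong:
  assumes "has_gen p pu l" "\<And>z. p z = p' z" "\<And>z. pu z = pu' z" "\<And>z. l z = l' z"
  shows "has_gen p' pu' l'"
proof -
  have "p' = p" "pu' = pu" "l' = l" using assms(2-4) by (auto intro: ext)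
  then show ?thesis using assms(1) by simp
qed

text \<open>The assumptions \<open>ax\<close> and \<open>ay\<close> identify the mixed derivatives,
  so that the generator applies to the \<open>u\<close>-derivative \<open>a\<close> itself and hence
  to the mixed term \<open>a * Y\<close> in \<open>Q\<close>.\<close>

lemma harmonic_gradient_zero:
  assumes jf: "harmonic_jet f a fuu fx fy"
    and jx: "harmonic_jet fx fxu fxuu fxx fxy" and jy: "harmonic_jet fy fyu fyuu fyx fyy"
    and ax: "\<And>u x y. ((\<lambda>t. a (u, t, y)) has_real_derivative fxu (u, x, y)) (at x)"
    and ay: "\<And>u x y. ((\<lambda>t. a (u, x, t)) has_real_derivative fyu (u, x, y)) (at y)"
    and bf: "\<And>p. \<bar>f p\<bar> \<le> C" and bfx: "\<And>p. \<bar>fx p\<bar> \<le> C" and bfy: "\<And>p. \<bar>fy p\<bar> \<le> C"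
  shows "fx p = 0 \<and> fy p = 0"
proof -
  define c s where "c z = cos (fst z)" and "s z = sin (fst z)" for z :: "real \<times> real \<times> real"
  define X Y \<alpha> \<beta> where "X z = c z * fx z + s z * fy z" and "Y z = c z * fy z - s z * fx z"
    and "\<alpha> z = c z * fxu z + s z * fyu z" and "\<beta> z = c z * fyu z - s z * fxu z" for z
  define G where "G z = (fx z)\<^sup>2 + (fy z)\<^sup>2" for z
  define Q where "Q z = 2 * (f z)\<^sup>2 + (a z)\<^sup>2 - a z * Y z + G z" for z
  have cs: "(c z)\<^sup>2 + (s z)\<^sup>2 = 1" for z by (simp add: c_def s_def)
  have C0: "0 \<le> C" using bf[of p] by linarith
  have bound: "\<bar>c z * v + s z * w\<bar> \<le> 2 * C" "\<bar>c z * v - s z * w\<bar> \<le> 2 * C"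
    if "\<bar>v\<bar> \<le> C" "\<bar>w\<bar> \<le> C" for v w z
  proof -
    have "\<bar>c z\<bar> \<le> 1" "\<bar>s z\<bar> \<le> 1" by (simp_all add: c_def s_def)
    then have "\<bar>c z * v\<bar> \<le> 1 * C" "\<bar>s z * w\<bar> \<le> 1 * C"
      unfolding abs_mult using that by (intro mult_mono; simp)+
    then show "\<bar>c z * v + s z * w\<bar> \<le> 2 * C" "\<bar>c z * v - s z * w\<bar> \<le> 2 * C" by linarith+
  qed
  have fuu: "fuu z = - 2 * X z" for z
  proof -
    obtain u x y where z: "z = (u, x, y)" by (cases z)
    have "fuu (u, x, y) / 2 + cos u * fx (u, x, y) + sin u * fy (u, x, y) = 0"
      using jf by (simp add: harmonic_jet_def)
    then show ?thesis by (simp add: z X_def c_def s_def)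
  qed
  have bX: "\<bar>X z\<bar> \<le> 2 * C" and bY: "\<bar>Y z\<bar> \<le> 2 * C" for z
    unfolding X_def Y_def using bound(1)[OF bfx bfy] bound(2)[OF bfy bfx] by auto
  \<comment> \<open>Landau's inequality with \<open>h = 1\<close>: the equation bounds
    \<open>fuu = - 2 * X\<close> by \<open>4 * C\<close>, and
    \<open>2 * C + 4 * C = 6 * C\<close>.\<close>
  have ba: "\<bar>a z\<bar> \<le> 6 * C" for z
  proof -
    obtain u x y where z: "z = (u, x, y)" by (cases z)
    have "\<bar>a (u, x, y)\<bar> \<le> 2 * C / 1 + (4 * C) * 1"
    proof (rule landau_derivative_bound[of "\<lambda>t. f (t, x, y)" "\<lambda>t. a (t, x, y)"
          "\<lambda>t. fuu (t, x, y)"])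
      show "\<bar>fuu (t, x, y)\<bar> \<le> 4 * C" for t using bX[of "(t, x, y)"] by (simp add: fuu abs_mult)
    qed (use jf bf in \<open>auto simp: harmonic_jet_def\<close>)
    then show ?thesis by (simp add: z)
  qed
  have gf: "has_gen f a (\<lambda>z. 0)" and gx: "has_gen fx fxu (\<lambda>z. 0)" and gy: "has_gen fy fyu (\<lambda>z. 0)"
    using jf jx jy by (auto intro: harmonic_jet_has_gen)
  have gc: "has_gen c (\<lambda>z. - s z) (\<lambda>z. - c z / 2)" and gs: "has_gen s c (\<lambda>z. - s z / 2)"
    using has_gen_cos has_gen_sin unfolding c_def s_def by auto
  \<comment> \<open>Formally, differentiating \<open>L f = 0\<close> in \<open>u\<close> gives
    \<open>L a = - Y\<close>, because the coefficients turn with \<open>u\<close>. Concretely, the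
    \<open>u\<close>-derivative of \<open>- 2 * X\<close> is \<open>- 2 * (Y + \<alpha>)\<close>,
    and the drift adds \<open>\<alpha>\<close>, which cancels.\<close>
  have ga: "has_gen a (\<lambda>z. - 2 * X z) (\<lambda>z. - Y z)"
    unfolding has_gen_def
  proof (rule exI[of _ "\<lambda>z. - 2 * (Y z + \<alpha> z)"], rule exI[of _ fxu], rule exI[of _ fyu], intro allI conjI)
    fix u x y
    show "((\<lambda>t. a (t, x, y)) has_real_derivative - 2 * X (u, x, y)) (at u)"
      using jf fuu by (auto simp: harmonic_jet_def)
    have d: "((\<lambda>t. fx (t, x, y)) has_real_derivative fxu (u, x, y)) (at u)"
       "((\<lambda>t. fy (t, x, y)) has_real_derivative fyu (u, x, y)) (at u)"
      using jx jy by (auto simp: harmonic_jet_def)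
    show "((\<lambda>t. - 2 * X (t, x, y)) has_real_derivative - 2 * (Y (u, x, y) + \<alpha> (u, x, y))) (at u)"
      unfolding X_def Y_def \<alpha>_def c_def s_def fst_conv
      by (rule derivative_eq_intros d refl | simp add: algebra_simps)+
    show "- Y (u, x, y) = - 2 * (Y (u, x, y) + \<alpha> (u, x, y)) / 2 + cos u * fxu (u, x, y) + sin u * fyu (u, x, y)"
      by (simp add: \<alpha>_def c_def s_def field_simps)
  qed (rule ax ay)+
  \<comment> \<open>The term \<open>- Y / 2\<close> comes from \<open>L cos = - cos / 2\<close> and
    \<open>L sin = - sin / 2\<close>, the term \<open>- \<alpha>\<close> from the cross terms of the
    product rule.\<close>
  have gY: "has_gen Y (\<lambda>z. \<beta> z - X z) (\<lambda>z. - Y z / 2 - \<alpha> z)"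
    by (rule has_gen_cong[OF has_gen_add[OF has_gen_mult[OF gc gy] has_gen_cmult[OF has_gen_mult[OF gs gx], of "-1"]]])
      (auto simp: Y_def \<beta>_def X_def \<alpha>_def field_simps)
  define LG where "LG z = (fxu z)\<^sup>2 + (fyu z)\<^sup>2" for z
  \<comment> \<open>By the product rule, \<open>2 * f\<^sup>2\<close> contributes
    \<open>2 * a\<^sup>2\<close>, and \<open>a\<^sup>2\<close> contributes
    \<open>4 * X\<^sup>2 - 2 * a * Y\<close>; the bracket is the generator of \<open>a * Y\<close>,
    left unexpanded.\<close>
  define LQ where "LQ z = 2 * (a z)\<^sup>2 + 4 * (X z)\<^sup>2 - 2 * a z * Y z
    - (- Y z * Y z + a z * (- Y z / 2 - \<alpha> z) + (- 2 * X z) * (\<beta> z - X z)) + LG z" for z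
  have LQ: "G z / 2 \<le> LQ z" for z
    using lyapunov_inequality[OF cs[of z], of "fx z" "fy z" "a z" "fxu z" "fyu z"]
    unfolding LQ_def LG_def G_def X_def Y_def \<alpha>_def \<beta>_def .
  have gG: "\<exists>Gu. has_gen G Gu LG"
    by (rule exI, rule has_gen_cong[OF has_gen_add[OF has_gen_mult[OF gx gx] has_gen_mult[OF gy gy]]])
      (auto simp: G_def LG_def power2_eq_square)
  then obtain Gu where gG: "has_gen G Gu LG" ..
  have "\<exists>Qu. has_gen Q Qu LQ"
    by (rule exI, rule has_gen_cong[OF has_gen_add[OF has_gen_add[OF has_gen_add[OF
        has_gen_cmult[OF has_gen_mult[OF gf gf], of 2] has_gen_mult[OF ga ga]]
        has_gen_cmult[OF has_gen_mult[OF ga gY], of "-1"]] gG]],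
        simp add: Q_def power2_eq_square, rule refl, simp add: LQ_def power2_eq_square algebra_simps)
  then obtain Qu where gQ: "has_gen Q Qu LQ" ..
  have cont: "continuous_on UNIV f" "continuous_on UNIV a" "continuous_on UNIV fx" "continuous_on UNIV fy"
    using jf by (auto simp: harmonic_jet_def)
  have cG: "continuous_on UNIV G" unfolding G_def by (intro continuous_intros cont)
  have cQ: "continuous_on UNIV Q"
    unfolding Q_def Y_def c_def s_def by (intro continuous_intros cont cG)
  have bsq: "v\<^sup>2 \<le> K\<^sup>2" if "\<bar>v\<bar> \<le> K" for v K :: real
    using that by (metis abs_ge_zero power2_abs power_mono)
  have bG: "0 \<le> G z" "G z \<le> 2 * C\<^sup>2" for z
    using bsq[OF bfx[of z]] bsq[OF bfy[of z]] by (auto simp: G_def)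
  \<comment> \<open>The four terms of \<open>Q\<close> are bounded by 2, 36, 12 and 2 times
    \<open>C\<^sup>2\<close>.\<close>
  define M where "M = 52 * C\<^sup>2"
  have bQ: "\<bar>Q z\<bar> \<le> M" for z
  proof -
    have "\<bar>a z * Y z\<bar> \<le> (6 * C) * (2 * C)"
      unfolding abs_mult using ba bY C0 by (intro mult_mono) auto
    then have "\<bar>a z * Y z\<bar> \<le> 12 * C\<^sup>2" by (simp add: power2_eq_square)
    moreover have "(a z)\<^sup>2 \<le> 36 * C\<^sup>2" using bsq[OF ba[of z]] by (simp add: power_mult_distrib)
    moreover have "(f z)\<^sup>2 \<le> C\<^sup>2" using bsq[OF bf[of z]] .
    moreover have "0 \<le> (f z)\<^sup>2" "0 \<le> (a z)\<^sup>2" by auto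
    ultimately show ?thesis using bG[of z] unfolding Q_def M_def by linarith
  qed
  have M0: "0 \<le> M" by (simp add: M_def)
  \<comment> \<open>The tolerance \<open>\<epsilon>\<^sup>2\<close> survives division by
    \<open>\<epsilon>\<close>: at the almost-maximum \<open>r\<close>, \<open>LG \<ge> 0\<close>
    gives \<open>LQ r \<le> \<epsilon>\<close>, so \<open>G r \<le> 2 * \<epsilon>\<close>.
    Comparing \<open>q\<close> with \<open>r\<close> costs
    \<open>\<epsilon>\<^sup>2 \<le> \<epsilon>\<close> and twice
    \<open>\<epsilon> * M\<close>.\<close>
  have small: "G q \<le> \<epsilon> * (3 + 2 * M)" if \<epsilon>: "0 < \<epsilon>" "\<epsilon> \<le> 1" for \<epsilon> q
  proof -
    have g: "has_gen (\<lambda>z. G z + \<epsilon> * Q z) (\<lambda>z. Gu z + \<epsilon> * Qu z) (\<lambda>z. LG z + \<epsilon> * LQ z)"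
      by (intro has_gen_add gG has_gen_cmult gQ)
    have eQ: "\<bar>\<epsilon> * Q z\<bar> \<le> \<epsilon> * M" for z
      unfolding abs_mult using \<epsilon> bQ by (intro mult_mono) auto
    have bW: "G z + \<epsilon> * Q z \<le> 2 * C\<^sup>2 + \<epsilon> * M" for z
      using eQ[of z] bG[of z] by linarith
    have cW: "continuous_on UNIV (\<lambda>z. G z + \<epsilon> * Q z)" by (intro continuous_intros cG cQ)
    have "0 < \<epsilon>\<^sup>2" using \<epsilon> by simp
    then obtain r where r: "(G q + \<epsilon> * Q q) - \<epsilon>\<^sup>2 \<le> G r + \<epsilon> * Q r" "LG r + \<epsilon> * LQ r \<le> \<epsilon>\<^sup>2"
      by (rule has_gen_almost_maximum[OF g cW bW])
    have "0 \<le> LG r" by (simp add: LG_def)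
    then have "\<epsilon> * LQ r \<le> \<epsilon> * \<epsilon>" using r(2) by (simp add: power2_eq_square)
    then have "G r \<le> 2 * \<epsilon>" using LQ[of r] \<epsilon> by simp
    moreover have "\<epsilon>\<^sup>2 \<le> \<epsilon>" using \<epsilon> by (simp add: power2_eq_square mult_left_le)
    ultimately show ?thesis using r(1) eQ[of q] eQ[of r] by (simp add: algebra_simps)
  qed
  have "G p \<le> 0"
  proof (rule ccontr)
    assume "\<not> G p \<le> 0"
    define k where "k = 3 + 2 * M"
    \<comment> \<open>For this choice the estimate \<open>small\<close> reads
      \<open>G p \<le> \<epsilon> * k \<le> G p / 2\<close>.\<close>
    define \<epsilon> where "\<epsilon> = min 1 (G p / (2 * k))"
    have k: "k > 0" using M0 by (simp add: k_def)
    then have "0 < \<epsilon>" "\<epsilon> \<le> 1" "\<epsilon> \<le> G p / (2 * k)"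
      using \<open>\<not> G p \<le> 0\<close> by (auto simp: \<epsilon>_def)
    then have "G p \<le> \<epsilon> * k" "\<epsilon> * k \<le> G p / (2 * k) * k"
      using small[of \<epsilon> p] mult_right_mono[of \<epsilon> "G p / (2 * k)" k] k
      by (simp_all add: k_def[symmetric])
    moreover have "G p / (2 * k) * k = G p / 2" using k by simp
    ultimately show False using \<open>\<not> G p \<le> 0\<close> by linarith
  qed
  then show ?thesis
    by (simp add: G_def sum_power2_le_zero_iff)
qed

section \<open>Averaging over boxes in the plane\<close>

text \<open>The integral is not divided by \<open>a\<close>, so its derivative along the window is
  the plain difference \<open>diff_x\<close>; the factors \<open>a\<close> reappear in the closeness
  estimates.\<close>

definition box_x :: "real \<Rightarrow> ('a \<times> real \<times> real \<Rightarrow> real) \<Rightarrow> 'a \<times> real \<times> real \<Rightarrow> real" where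
  "box_x a g = (\<lambda>(u, x, y). integral {0..a} (\<lambda>s. g (u, x + s, y)))"

definition box_y :: "real \<Rightarrow> ('a \<times> real \<times> real \<Rightarrow> real) \<Rightarrow> 'a \<times> real \<times> real \<Rightarrow> real" where
  "box_y a g = (\<lambda>(u, x, y). integral {0..a} (\<lambda>s. g (u, x, y + s)))"

definition diff_x :: "real \<Rightarrow> ('a \<times> real \<times> real \<Rightarrow> real) \<Rightarrow> 'a \<times> real \<times> real \<Rightarrow> real" where
  "diff_x a g = (\<lambda>(u, x, y). g (u, x + a, y) - g (u, x, y))"

definition diff_y :: "real \<Rightarrow> ('a \<times> real \<times> real \<Rightarrow> real) \<Rightarrow> 'a \<times> real \<times> real \<Rightarrow> real" where
  "diff_y a g = (\<lambda>(u, x, y). g (u, x, y + a) - g (u, x, y))"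

context
  fixes g :: "real \<times> real \<times> real \<Rightarrow> real"
  assumes g: "continuous_on UNIV g"
begin

lemma continuous_on_line:
  "continuous_on S (\<lambda>t. g (t, x, y))" "continuous_on S (\<lambda>t. g (u, t, y))"
  "continuous_on S (\<lambda>t. g (u, x, t))" "continuous_on S (\<lambda>t. g (u, x + t, y))"
  "continuous_on S (\<lambda>t. g (u, x, y + t))"
  by (rule continuous_on_compose2[OF g], intro continuous_intros, simp)+

lemma continuous_on_box_x: "continuous_on UNIV (box_x a g)"
  unfolding box_x_def split_beta
  by (intro continuous_on_integral_param continuous_on_compose2[OF g] continuous_intros) simp

lemma continuous_on_box_y: "continuous_on UNIV (box_y a g)"
  unfolding box_y_def split_beta
  by (intro continuous_on_integral_param continuous_on_compose2[OF g] continuous_intros) simp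

lemma continuous_on_diff_x: "continuous_on UNIV (diff_x a g)"
  unfolding diff_x_def split_beta
  by (intro continuous_intros continuous_on_compose2[OF g]) simp_all

lemma continuous_on_diff_y: "continuous_on UNIV (diff_y a g)"
  unfolding diff_y_def split_beta
  by (intro continuous_intros continuous_on_compose2[OF g]) simp_all

lemma box_x_derivative_x:
  "0 \<le> a \<Longrightarrow> ((\<lambda>t. box_x a g (u, t, y)) has_real_derivative diff_x a g (u, x, y)) (at x)"
  unfolding box_x_def diff_x_def split
  by (rule has_real_derivative_integral_window[of "\<lambda>t. g (u, t, y)"]) (rule continuous_on_line)

lemma box_y_derivative_y:
  "0 \<le> a \<Longrightarrow> ((\<lambda>t. box_y a g (u, x, t)) has_real_derivative diff_y a g (u, x, y)) (at y)"
  unfolding box_y_def diff_y_def split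
  by (rule has_real_derivative_integral_window[of "\<lambda>t. g (u, x, t)"]) (rule continuous_on_line)

context
  fixes g' :: "real \<times> real \<times> real \<Rightarrow> real"
  assumes g': "continuous_on UNIV g'"
begin

lemma box_derivative_u:
  assumes "\<And>u x y. ((\<lambda>t. g (t, x, y)) has_real_derivative g' (u, x, y)) (at u)"
  shows "((\<lambda>t. box_x a g (t, x, y)) has_real_derivative box_x a g' (u, x, y)) (at u)"
    and "((\<lambda>t. box_y a g (t, x, y)) has_real_derivative box_y a g' (u, x, y)) (at u)"
  unfolding box_x_def box_y_def split
  by (rule has_real_derivative_integral_param,
      rule assms, intro continuous_on_compose2[OF g'] continuous_intros, simp, rule continuous_on_line)+

lemma box_x_derivative_y:
  assumes "\<And>u x y. ((\<lambda>t. g (u, x, t)) has_real_derivative g' (u, x, y)) (at y)"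
  shows "((\<lambda>t. box_x a g (u, x, t)) has_real_derivative box_x a g' (u, x, y)) (at y)"
  unfolding box_x_def split
  by (rule has_real_derivative_integral_param,
      rule assms, intro continuous_on_compose2[OF g'] continuous_intros, simp, rule continuous_on_line)

lemma box_y_derivative_x:
  assumes "\<And>u x y. ((\<lambda>t. g (u, t, y)) has_real_derivative g' (u, x, y)) (at x)"
  shows "((\<lambda>t. box_y a g (u, t, y)) has_real_derivative box_y a g' (u, x, y)) (at x)"
  unfolding box_y_def split
  by (rule has_real_derivative_integral_param,
      rule assms, intro continuous_on_compose2[OF g'] continuous_intros, simp, rule continuous_on_line)

end

text \<open>Used in two ways: \<open>c = 0\<close> bounds the integral by the supremum of
  \<open>g\<close>, and \<open>c\<close> a value of \<open>g\<close> measures the approximation for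
  small \<open>a\<close>.\<close>

lemma box_x_close:
  assumes "0 \<le> a" "\<And>s. 0 \<le> s \<Longrightarrow> s \<le> a \<Longrightarrow> \<bar>g (u, x + s, y) - c\<bar> \<le> e"
  shows "\<bar>box_x a g (u, x, y) - a * c\<bar> \<le> a * e"
proof -
  have "norm (integral {0..a} (\<lambda>s. g (u, x + s, y) - c)) \<le> e * (a - 0)"
    using assms by (intro integral_bound continuous_intros continuous_on_line) auto
  moreover have "integral {0..a} (\<lambda>s. g (u, x + s, y) - c) = box_x a g (u, x, y) - a * c"
    unfolding box_x_def split using assms(1)
    by (subst integral_diff)
      (auto intro!: integrable_continuous_interval continuous_on_line simp: mult.commute)
  ultimately show ?thesis by (simp add: mult.commute)
qed

lemma box_y_close:
  assumes "0 \<le> a" "\<And>s. 0 \<le> s \<Longrightarrow> s \<le> a \<Longrightarrow> \<bar>g (u, x, y + s) - c\<bar> \<le> e"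
  shows "\<bar>box_y a g (u, x, y) - a * c\<bar> \<le> a * e"
proof -
  have "norm (integral {0..a} (\<lambda>s. g (u, x, y + s) - c)) \<le> e * (a - 0)"
    using assms by (intro integral_bound continuous_intros continuous_on_line) auto
  moreover have "integral {0..a} (\<lambda>s. g (u, x, y + s) - c) = box_y a g (u, x, y) - a * c"
    unfolding box_y_def split using assms(1)
    by (subst integral_diff)
      (auto intro!: integrable_continuous_interval continuous_on_line simp: mult.commute)
  ultimately show ?thesis by (simp add: mult.commute)
qed

end

section \<open>Harmonicity under translations, differences and averages in the plane\<close>

lemma harmonic_jet_shift:
  assumes "harmonic_jet f fu fuu fx fy"
  shows "harmonic_jet (\<lambda>(u, x, y). f (u, x + a, y + b)) (\<lambda>(u, x, y). fu (u, x + a, y + b))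
    (\<lambda>(u, x, y). fuu (u, x + a, y + b)) (\<lambda>(u, x, y). fx (u, x + a, y + b)) (\<lambda>(u, x, y). fy (u, x + a, y + b))"
proof -
  \<comment> \<open>The coefficients of \<open>L\<close> depend on \<open>u\<close> alone, so a
    translate in the plane solves the same equation.\<close>
  have "continuous_on UNIV (\<lambda>(u, x, y). g (u, x + a, y + b))"
    if "continuous_on UNIV g" for g :: "real \<times> real \<times> real \<Rightarrow> real"
    unfolding split_beta by (intro continuous_on_compose2[OF that] continuous_intros) simp
  moreover have "((\<lambda>t. f (u, t + a, y)) has_real_derivative fx (u, x + a, y)) (at x)"
    "((\<lambda>t. f (u, x, t + b)) has_real_derivative fy (u, x, y + b)) (at y)" for u x y
    using assms
    by (subst DERIV_shift[of "\<lambda>t. f (u, t, y)" _ x a, symmetric]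
          DERIV_shift[of "\<lambda>t. f (u, x, t)" _ y b, symmetric]; simp add: harmonic_jet_def)+
  ultimately show ?thesis using assms unfolding harmonic_jet_def by auto
qed

lemma harmonic_jet_diff:
  assumes "harmonic_jet f fu fuu fx fy" "harmonic_jet g gu guu gx gy"
  shows "harmonic_jet (\<lambda>z. f z - g z) (\<lambda>z. fu z - gu z) (\<lambda>z. fuu z - guu z)
    (\<lambda>z. fx z - gx z) (\<lambda>z. fy z - gy z)"
  using assms unfolding harmonic_jet_def
  by (auto intro!: DERIV_diff continuous_on_diff)
    (smt (verit) add_divide_distrib diff_add_cancel distrib_left)

lemma harmonic_jet_diff_x:
  assumes "harmonic_jet f fu fuu fx fy"
  shows "harmonic_jet (diff_x a f) (diff_x a fu) (diff_x a fuu) (diff_x a fx) (diff_x a fy)"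
proof -
  have "diff_x a g = (\<lambda>z. (\<lambda>(u, x, y). g (u, x + a, y + 0)) z - g z)"
    for g :: "real \<times> real \<times> real \<Rightarrow> real"
    by (auto simp: diff_x_def)
  then show ?thesis
    using harmonic_jet_diff[OF harmonic_jet_shift[OF assms, of a 0] assms] by (simp only:)
qed

lemma harmonic_jet_diff_y:
  assumes "harmonic_jet f fu fuu fx fy"
  shows "harmonic_jet (diff_y a f) (diff_y a fu) (diff_y a fuu) (diff_y a fx) (diff_y a fy)"
proof -
  have "diff_y a g = (\<lambda>z. (\<lambda>(u, x, y). g (u, x + 0, y + a)) z - g z)"
    for g :: "real \<times> real \<times> real \<Rightarrow> real"
    by (auto simp: diff_y_def)
  then show ?thesis
    using harmonic_jet_diff[OF harmonic_jet_shift[OF assms, of 0 a] assms] by (simp only:)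
qed

lemma abs_diff_x_le: "(\<And>p. \<bar>g p\<bar> \<le> C) \<Longrightarrow> \<bar>diff_x a g p\<bar> \<le> 2 * C"
proof -
  assume g: "\<And>p. \<bar>g p\<bar> \<le> C"
  obtain u x y where "p = (u, x, y)" by (cases p)
  then show "\<bar>diff_x a g p\<bar> \<le> 2 * C"
    using g[of "(u, x + a, y)"] g[of "(u, x, y)"] by (simp add: diff_x_def)
qed

lemma abs_diff_y_le: "(\<And>p. \<bar>g p\<bar> \<le> C) \<Longrightarrow> \<bar>diff_y a g p\<bar> \<le> 2 * C"
proof -
  assume g: "\<And>p. \<bar>g p\<bar> \<le> C"
  obtain u x y where "p = (u, x, y)" by (cases p)
  then show "\<bar>diff_y a g p\<bar> \<le> 2 * C"
    using g[of "(u, x, y + a)"] g[of "(u, x, y)"] by (simp add: diff_y_def)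
qed

text \<open>For fixed \<open>u\<close> the coefficients \<open>cos u\<close> and
  \<open>sin u\<close> are the constants \<open>k\<close> and \<open>m\<close>, so
  \<open>L f = 0\<close> can be integrated along a line in the plane.\<close>

lemma integral_combination_zero:
  fixes A B D :: "real \<Rightarrow> real"
  assumes "continuous_on {0..a} A" "continuous_on {0..a} B" "continuous_on {0..a} D"
    and "\<And>s. A s / 2 + k * B s + m * D s = 0"
  shows "integral {0..a} A / 2 + k * integral {0..a} B + m * integral {0..a} D = 0"
proof -
  have "((\<lambda>s. A s / 2 + k * B s + m * D s) has_integral
      (integral {0..a} A / 2 + k * integral {0..a} B + m * integral {0..a} D)) {0..a}"
    by (intro has_integral_add has_integral_divide has_integral_mult_right integrable_integral
        integrable_continuous_interval assms)
  then show ?thesis using assms(4) by simp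
qed

text \<open>The \<open>x\<close>-derivative is recorded as \<open>diff_x a f\<close>, which inherits
  boundedness from \<open>f\<close>. By the fundamental theorem it equals \<open>box_x a fx\<close>,
  the form in which the equation integrates.\<close>

lemma harmonic_jet_box_x:
  assumes j: "harmonic_jet f fu fuu fx fy" and a: "0 \<le> a"
  shows "harmonic_jet (box_x a f) (box_x a fu) (box_x a fuu) (diff_x a f) (box_x a fy)"
proof -
  have c: "continuous_on UNIV f" "continuous_on UNIV fu" "continuous_on UNIV fuu"
      "continuous_on UNIV fx" "continuous_on UNIV fy"
    using j by (auto simp: harmonic_jet_def)
  have fx: "diff_x a f (u, x, y) = box_x a fx (u, x, y)" for u x y
  proof -
    have "((\<lambda>s. fx (u, x + s, y)) has_integral f (u, x + a, y) - f (u, x + 0, y)) {0..a}"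
    proof (rule fundamental_theorem_of_calculus[OF a])
      fix s
      have "((\<lambda>t. f (u, t, y)) has_real_derivative fx (u, s + x, y)) (at (s + x))"
        using j by (auto simp: harmonic_jet_def)
      then show "((\<lambda>s. f (u, x + s, y)) has_vector_derivative fx (u, x + s, y)) (at s within {0..a})"
        unfolding DERIV_shift by (auto simp: add.commute has_real_derivative_iff_has_vector_derivative
            intro: has_vector_derivative_at_within)
    qed
    then show ?thesis by (auto simp: box_x_def diff_x_def dest: integral_unique)
  qed
  have "box_x a fuu (u, x, y) / 2 + cos u * diff_x a f (u, x, y) + sin u * box_x a fy (u, x, y) = 0" for u x y
    unfolding fx unfolding box_x_def split
    by (rule integral_combination_zero; (rule continuous_on_line c)?)
      (use j in \<open>auto simp: harmonic_jet_def\<close>)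
  then show ?thesis
    using j a unfolding harmonic_jet_def
    by (auto intro!: continuous_on_box_x continuous_on_diff_x box_x_derivative_x box_x_derivative_y
        box_derivative_u)
qed

lemma harmonic_jet_box_y:
  assumes j: "harmonic_jet f fu fuu fx fy" and a: "0 \<le> a"
  shows "harmonic_jet (box_y a f) (box_y a fu) (box_y a fuu) (box_y a fx) (diff_y a f)"
proof -
  have c: "continuous_on UNIV f" "continuous_on UNIV fu" "continuous_on UNIV fuu"
      "continuous_on UNIV fx" "continuous_on UNIV fy"
    using j by (auto simp: harmonic_jet_def)
  have fy: "diff_y a f (u, x, y) = box_y a fy (u, x, y)" for u x y
  proof -
    have "((\<lambda>s. fy (u, x, y + s)) has_integral f (u, x, y + a) - f (u, x, y + 0)) {0..a}"
    proof (rule fundamental_theorem_of_calculus[OF a])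
      fix s
      have "((\<lambda>t. f (u, x, t)) has_real_derivative fy (u, x, s + y)) (at (s + y))"
        using j by (auto simp: harmonic_jet_def)
      then show "((\<lambda>s. f (u, x, y + s)) has_vector_derivative fy (u, x, y + s)) (at s within {0..a})"
        unfolding DERIV_shift by (auto simp: add.commute has_real_derivative_iff_has_vector_derivative
            intro: has_vector_derivative_at_within)
    qed
    then show ?thesis by (auto simp: box_y_def diff_y_def dest: integral_unique)
  qed
  have "box_y a fuu (u, x, y) / 2 + cos u * box_y a fx (u, x, y) + sin u * diff_y a f (u, x, y) = 0" for u x y
    unfolding fy unfolding box_y_def split
    by (rule integral_combination_zero; (rule continuous_on_line c)?)
      (use j in \<open>auto simp: harmonic_jet_def\<close>)
  then show ?thesis
    using j a unfolding harmonic_jet_def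
    by (auto intro!: continuous_on_box_y continuous_on_diff_y box_y_derivative_x box_y_derivative_y
        box_derivative_u)
qed

section \<open>Vanishing of the plane gradient and constancy on the line\<close>

lemma box_average_independent_of_position:
  assumes j: "harmonic_jet f fu fuu fx fy" and bd: "\<And>p. \<bar>f p\<bar> \<le> C" and a: "0 \<le> a"
  shows "box_x a (box_y a f) (u, x, y) = box_x a (box_y a f) (u, x', y')"
proof -
  note jy = harmonic_jet_box_y[OF j a] and jdy = harmonic_jet_diff_y[OF j]
  have c: "continuous_on UNIV f" "continuous_on UNIV fu" using j by (auto simp: harmonic_jet_def)
  \<comment> \<open>Averaging in both directions turns each plane derivative into an average of a
    difference of \<open>f\<close>. Both derivatives are therefore bounded, without any bound on
    \<open>fx\<close> or \<open>fy\<close>, and are harmonic with jets of their own.\<close>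
  have jF: "harmonic_jet (box_x a (box_y a f)) (box_x a (box_y a fu)) (box_x a (box_y a fuu))
      (diff_x a (box_y a f)) (box_x a (diff_y a f))"
    by (rule harmonic_jet_box_x[OF jy a])
  have bby: "\<bar>box_y a f p\<bar> \<le> a * C" for p
    using box_y_close[OF c(1) a, of "fst p" "fst (snd p)" "snd (snd p)" 0 C] bd by simp
  have bdy: "\<bar>diff_y a f p\<bar> \<le> 2 * C" for p
    by (rule abs_diff_y_le[OF bd])
  have b1: "\<bar>box_x a (box_y a f) p\<bar> \<le> a * (a * C)" for p
    using box_x_close[OF continuous_on_box_y[OF c(1), of a] a, of "fst p" "fst (snd p)" "snd (snd p)" 0] bby
    by simp
  have b2: "\<bar>diff_x a (box_y a f) p\<bar> \<le> 2 * (a * C)" for p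
    by (rule abs_diff_x_le[OF bby])
  have b3: "\<bar>box_x a (diff_y a f) p\<bar> \<le> a * (2 * C)" for p
    using box_x_close[OF continuous_on_diff_y[OF c(1), of a] a, of "fst p" "fst (snd p)" "snd (snd p)" 0] bdy
    by simp
  define K where "K = max (a * (a * C)) (2 * (a * C))"
  have zero: "diff_x a (box_y a f) p = 0 \<and> box_x a (diff_y a f) p = 0" for p
  proof (rule harmonic_gradient_zero[OF jF, where C = K])
    show "harmonic_jet (diff_x a (box_y a f)) (diff_x a (box_y a fu)) (diff_x a (box_y a fuu))
        (diff_x a (box_y a fx)) (diff_x a (diff_y a f))"
      by (rule harmonic_jet_diff_x[OF jy])
    show "harmonic_jet (box_x a (diff_y a f)) (box_x a (diff_y a fu)) (box_x a (diff_y a fuu))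
        (diff_x a (diff_y a f)) (box_x a (diff_y a fy))"
      by (rule harmonic_jet_box_x[OF jdy a])
  qed (use b1 b2 b3 in \<open>auto simp: K_def le_max_iff_disj mult.left_commute
      intro!: box_x_derivative_x box_x_derivative_y box_y_derivative_y continuous_on_box_y
        continuous_on_diff_y c a\<close>)
  have "((\<lambda>t. box_x a (box_y a f) (u, t, y)) has_real_derivative 0) (at x)"
       "((\<lambda>t. box_x a (box_y a f) (u, x, t)) has_real_derivative 0) (at y)" for x y
    using jF zero by (auto simp: harmonic_jet_def)
  then show ?thesis by (metis DERIV_isconst_all)
qed

lemma box_average_tendsto:
  fixes f :: "real \<times> real \<times> real \<Rightarrow> real"
  assumes c: "continuous_on UNIV f" and e: "e > 0"
  obtains d where "d > 0" "\<And>a. 0 \<le> a \<Longrightarrow> a < d \<Longrightarrow>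
    \<bar>box_x a (box_y a f) (u, x, y) - a * (a * f (u, x, y))\<bar> \<le> a * (a * e)"
proof -
  obtain d where d: "d > 0" "\<And>q. dist q (u, x, y) < d \<Longrightarrow> dist (f q) (f (u, x, y)) < e"
    using c e unfolding continuous_on_iff by (metis UNIV_I)
  show thesis
  proof
    \<comment> \<open>Half of \<open>d\<close> suffices because a point of the box is within
      \<open>s + t \<le> 2 * a\<close> of its corner.\<close>
    show "d / 2 > 0" using d by simp
    fix a :: real assume a: "0 \<le> a" "a < d / 2"
    have "\<bar>f (u, x + s, y + t) - f (u, x, y)\<bar> \<le> e" if "0 \<le> s" "s \<le> a" "0 \<le> t" "t \<le> a" for s t
    proof -
      have "dist (u, x + s, y + t) (u, x, y) \<le> s + t"
        using sqrt_sum_squares_le_sum[of s t] that by (simp add: dist_Pair_Pair dist_real_def)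
      then show ?thesis using d(2)[of "(u, x + s, y + t)"] that a by (simp add: dist_real_def)
    qed
    then show "\<bar>box_x a (box_y a f) (u, x, y) - a * (a * f (u, x, y))\<bar> \<le> a * (a * e)"
      using a by (intro box_x_close box_y_close continuous_on_box_y c) auto
  qed
qed

lemma bounded_harmonic_jet_constant:
  assumes j: "harmonic_jet f fu fuu fx fy" and bd: "\<And>p. \<bar>f p\<bar> \<le> C"
  shows "f p = f q"
proof -
  have c: "continuous_on UNIV f" using j by (auto simp: harmonic_jet_def)
  have flat: "f (u, x, y) = f (u, x', y')" for u x y x' y'
  proof (rule ccontr)
    assume ne: "f (u, x, y) \<noteq> f (u, x', y')"
    \<comment> \<open>A third of the gap: the two double averages coincide and each lies within
      \<open>a * (a * e)\<close> of its value times \<open>a * a\<close>, so the gap would be at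
      most \<open>2 * e\<close>.\<close>
    define e where "e = \<bar>f (u, x, y) - f (u, x', y')\<bar> / 3"
    have e: "e > 0" using ne by (simp add: e_def)
    obtain d where d: "d > 0" "\<And>a. 0 \<le> a \<Longrightarrow> a < d \<Longrightarrow>
        \<bar>box_x a (box_y a f) (u, x, y) - a * (a * f (u, x, y))\<bar> \<le> a * (a * e)"
      using box_average_tendsto[OF c e] by blast
    obtain d' where d': "d' > 0" "\<And>a. 0 \<le> a \<Longrightarrow> a < d' \<Longrightarrow>
        \<bar>box_x a (box_y a f) (u, x', y') - a * (a * f (u, x', y'))\<bar> \<le> a * (a * e)"
      using box_average_tendsto[OF c e] by blast
    define a where "a = min d d' / 2"
    have a: "0 < a" "a < d" "a < d'" using d d' by (auto simp: a_def)
    have "\<bar>a * (a * f (u, x, y)) - a * (a * f (u, x', y'))\<bar> \<le> 2 * (a * (a * e))"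
      using d(2)[of a] d'(2)[of a] a box_average_independent_of_position[OF j bd, of a u x y x' y'] by linarith
    moreover have "a * (a * f (u, x, y)) - a * (a * f (u, x', y')) = (a * a) * (f (u, x, y) - f (u, x', y'))"
      by (simp add: algebra_simps)
    ultimately have "(a * a) * \<bar>f (u, x, y) - f (u, x', y')\<bar> \<le> (a * a) * (2 * e)"
      using a by (simp add: abs_mult)
    then have "\<bar>f (u, x, y) - f (u, x', y')\<bar> \<le> 2 * e" using a by simp
    then show False using e by (simp add: e_def)
  qed
  have zero: "fx (u, x, y) = 0" "fy (u, x, y) = 0" for u x y
  proof -
    have "((\<lambda>t. f (u, t, y)) has_real_derivative fx (u, x, y)) (at x)"
      "((\<lambda>t. f (u, x, t)) has_real_derivative fy (u, x, y)) (at y)"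
      using j by (auto simp: harmonic_jet_def)
    moreover have "(\<lambda>t. f (u, t, y)) = (\<lambda>t. f (u, x, y))" "(\<lambda>t. f (u, x, t)) = (\<lambda>t. f (u, x, y))"
      by (rule ext, rule flat)+
    ultimately show "fx (u, x, y) = 0" "fy (u, x, y) = 0"
      by (auto intro: DERIV_unique)
  qed
  have du: "((\<lambda>t. f (t, x, y)) has_real_derivative fu (u, x, y)) (at u)"
    and duu: "((\<lambda>t. fu (t, x, y)) has_real_derivative 0) (at u)" for u x y
  proof -
    have "fuu (u, x, y) / 2 + cos u * fx (u, x, y) + sin u * fy (u, x, y) = 0"
      "((\<lambda>t. fu (t, x, y)) has_real_derivative fuu (u, x, y)) (at u)"
      using j by (auto simp: harmonic_jet_def)
    then show "((\<lambda>t. fu (t, x, y)) has_real_derivative 0) (at u)" by (simp add: zero)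
  qed (use j in \<open>auto simp: harmonic_jet_def\<close>)
  have "fu (u, x, y) = 0" for u x y
  proof (rule ccontr)
    assume ne: "fu (u, x, y) \<noteq> 0"
    have C0: "0 \<le> C" using bd[of p] by linarith
    \<comment> \<open>Since the second \<open>u\<close>-derivative vanishes, Landau's inequality
      with \<open>K = 0\<close> gives \<open>h * \<bar>fu (u, x, y)\<bar> \<le> 2 * C\<close>; this
      \<open>h\<close> makes the left side \<open>2 * C + 1\<close>.\<close>
    define h where "h = (2 * C + 1) / \<bar>fu (u, x, y)\<bar>"
    have h: "h > 0" using ne C0 by (simp add: h_def)
    have "\<bar>fu (u, x, y)\<bar> \<le> 2 * C / h + 0 * h"
      by (rule landau_derivative_bound[OF du duu]) (use bd h in auto)
    then have "h * \<bar>fu (u, x, y)\<bar> \<le> 2 * C" using h by (simp add: field_simps)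
    then show False using ne by (simp add: h_def)
  qed
  then have "f (u, x, y) = f (u', x, y)" for u u' x y
    using du by (metis DERIV_isconst_all)
  then show ?thesis using flat by (metis prod.exhaust)
qed

section \<open>Passage from the two notions of harmonicity to jets on the line\<close>

lemma to_circle_add: "to_circle (s + t) = to_circle s + to_circle t"
  by (simp add: plus_circle.abs_eq)

lemma continuous_on_to_circle: "continuous_on UNIV to_circle"
  by (simp add: continuous_on_open_vimage open_circle_def)

text \<open>As \<open>to_circle\<close> is additive, the curve
  \<open>t \<mapsto> to_circle u + to_circle t\<close> is the projection of the line shifted by
  \<open>u\<close>, so the circle derivative, taken at 0, is the derivative of the lift at
  \<open>u\<close>.\<close>

lemma harmonic_jet_lift:
  assumes h: "L_harmonic_circle f"
  defines "lift \<equiv> \<lambda>g (u, x, y). g (to_circle u, x, y)"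
  shows "harmonic_jet (lift f) (lift (partial_u_circle f)) (lift (partial_u_circle (partial_u_circle f)))
    (lift (partial_z1 f)) (lift (partial_z2 f))"
proof -
  have cont: "continuous_on UNIV (lift g)" if "continuous_on UNIV g" for g :: "circle \<times> real \<times> real \<Rightarrow> real"
    unfolding lift_def split_beta
    by (intro continuous_on_compose2[OF that] continuous_intros
        continuous_on_compose2[OF continuous_on_to_circle]) auto
  have du: "((\<lambda>t. g (to_circle t, x, y)) has_real_derivative partial_u_circle g (to_circle u, x, y)) (at u)"
    if "(\<lambda>t. g (to_circle u + to_circle t, x, y)) differentiable (at 0)"
    for g :: "circle \<times> real \<times> real \<Rightarrow> real" and u x y
  proof -
    have "((\<lambda>t. g (to_circle (t + u), x, y)) has_real_derivative partial_u_circle g (to_circle u, x, y)) (at 0)"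
      using that by (simp add: to_circle_add partial_u_circle_def add.commute DERIV_deriv_iff_real_differentiable)
    then show ?thesis using DERIV_shift[of "\<lambda>t. g (to_circle t, x, y)" _ 0 u] by simp
  qed
  have r: "kinetic_regular_circle f" and L: "kinetic_gen_circle f p = 0" for p
    using h unfolding L_harmonic_circle_def by blast+
  have "partial_u_circle (partial_u_circle f) (to_circle u, x, y) / 2
      + cos u * partial_z1 f (to_circle u, x, y) + sin u * partial_z2 f (to_circle u, x, y) = 0" for u x y
    using L[of "(to_circle u, x, y)"]
    by (simp add: kinetic_gen_circle_def cos_circle.abs_eq sin_circle.abs_eq)
  moreover have "((\<lambda>t. f (to_circle u, t, y)) has_real_derivative partial_z1 f (to_circle u, x, y)) (at x)"
    "((\<lambda>t. f (to_circle u, x, t)) has_real_derivative partial_z2 f (to_circle u, x, y)) (at y)" for u x y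
    using r by (auto simp: kinetic_regular_circle_def partial_z1_def partial_z2_def
        DERIV_deriv_iff_real_differentiable)
  moreover have "((\<lambda>t. f (to_circle t, x, y)) has_real_derivative partial_u_circle f (to_circle u, x, y)) (at u)"
    "((\<lambda>t. partial_u_circle f (to_circle t, x, y)) has_real_derivative
       partial_u_circle (partial_u_circle f) (to_circle u, x, y)) (at u)" for u x y
    using r by (auto simp: kinetic_regular_circle_def intro!: du)
  moreover have "continuous_on UNIV (lift f)" "continuous_on UNIV (lift (partial_u_circle f))"
    "continuous_on UNIV (lift (partial_u_circle (partial_u_circle f)))"
    "continuous_on UNIV (lift (partial_z1 f))" "continuous_on UNIV (lift (partial_z2 f))"
    using r by (auto simp: kinetic_regular_circle_def intro: cont)
  ultimately show ?thesis
    unfolding harmonic_jet_def by (intro conjI allI) (simp_all add: lift_def)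
qed

lemma harmonic_jet_partials:
  assumes "L_harmonic f"
  shows "harmonic_jet f (partial_u f) (partial_u (partial_u f)) (partial_z1 f) (partial_z2 f)"
proof -
  have r: "kinetic_regular f" and L: "kinetic_gen f p = 0" for p
    using assms unfolding L_harmonic_def by blast+
  have du: "((\<lambda>t. g (t, x, y)) has_real_derivative partial_u g (u, x, y)) (at u)"
    if "(\<lambda>t. g (t, x, y)) differentiable (at u)" for g u x y
    using that by (simp add: partial_u_def DERIV_deriv_iff_real_differentiable)
  have "((\<lambda>t. f (t, x, y)) has_real_derivative partial_u f (u, x, y)) (at u)"
    "((\<lambda>t. partial_u f (t, x, y)) has_real_derivative partial_u (partial_u f) (u, x, y)) (at u)"
    for u x y
    using r by (auto simp: kinetic_regular_def intro!: du)
  moreover have "((\<lambda>t. f (u, t, y)) has_real_derivative partial_z1 f (u, x, y)) (at x)"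
    "((\<lambda>t. f (u, x, t)) has_real_derivative partial_z2 f (u, x, y)) (at y)" for u x y
    using r by (auto simp: kinetic_regular_def partial_z1_def partial_z2_def
        DERIV_deriv_iff_real_differentiable)
  moreover have "partial_u (partial_u f) (u, x, y) / 2
      + cos u * partial_z1 f (u, x, y) + sin u * partial_z2 f (u, x, y) = 0" for u x y
    using L[of "(u, x, y)"] by (simp add: kinetic_gen_def)
  ultimately show ?thesis using r unfolding harmonic_jet_def kinetic_regular_def by auto
qed

theorem theorem5p3:
  "(\<forall>f :: circle \<times> real \<times> real \<Rightarrow> real.
      L_harmonic_circle f \<and> bounded (range f) \<longrightarrow> f constant_on UNIV) \<and>
   (\<forall>f :: real \<times> real \<times> real \<Rightarrow> real.
      L_harmonic f \<and> bounded (range f) \<longrightarrow> f constant_on UNIV)"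
proof (intro conjI allI impI; elim conjE)
  fix f :: "circle \<times> real \<times> real \<Rightarrow> real"
  assume h: "L_harmonic_circle f" and "bounded (range f)"
  then obtain C where C: "\<And>p. \<bar>f p\<bar> \<le> C" by (auto simp: bounded_iff)
  \<comment> \<open>The lift is constant, and constancy descends to the circle because
    \<open>to_circle\<close> is onto.\<close>
  have "f (to_circle u, x, y) = f (to_circle u', x', y')" for u x y u' x' y'
    using bounded_harmonic_jet_constant[OF harmonic_jet_lift[OF h], of C "(u, x, y)" "(u', x', y')"] C
    by (auto simp: split_beta)
  moreover have "\<exists>u. b = to_circle u" for b
    by (induct b rule: circle.abs_induct) auto
  ultimately have "f (b, x, y) = f (b', x', y')" for b x y b' x' y'
    by metis
  then show "f constant_on UNIV" unfolding constant_on_def by (metis prod.exhaust)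
next
  fix f :: "real \<times> real \<times> real \<Rightarrow> real"
  assume h: "L_harmonic f" and "bounded (range f)"
  then obtain C where C: "\<And>p. \<bar>f p\<bar> \<le> C" by (auto simp: bounded_iff)
  have "f p = f q" for p q
    by (rule bounded_harmonic_jet_constant[OF harmonic_jet_partials[OF h] C])
  then show "f constant_on UNIV" unfolding constant_on_def by metis
qed

end
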